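(* Let $a$ and $b$ be positive integers and, for positive integers $k$, let $\zeta_{a,b}(k)=\sum_{m\geqslant 1} m^{-(ak+b)}$. Suppose that for some $R>0$ we have $\zeta_{a,b}(k)\in\mathbb{Q}$ for all integers $k\geqslant R$. For each integer $k\geqslant R$, define the pair of coprime positive integers $p_k$ and $q_k$ by $p_k/q_k=\zeta_{a,b}(k)$. Then the sequence $\{q_k\}_{k\geqslant R}$ is unbounded. *)

theory Defs
  imports "HOL-Analysis.Analysis"
begin

(* Index shift: the summation variable m >= 1 is written as Suc m.  For a, b, k >= 1 the
   exponent is at least 2, so the series converges and suminf is its genuine sum. *)
definition zeta_ab :: "nat \<Rightarrow> nat \<Rightarrow> nat \<Rightarrow> real" where
  "zeta_ab a b k = (\<Sum>m. 1 / real (Suc m) ^ (a * k + b))"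

end

theory Submission
  imports Defs
begin

text \<open>
  The excess of the zeta value over its first term 1 is positive and tends to 0 as \<open>k\<close> grows,
  because every base in the tail is at least 2 (\<open>zeta_ab_gt_1\<close>, \<open>zeta_ab_minus_1_le\<close>). But a
  fraction larger than 1 with denominator \<open>q\<close> exceeds 1 by at least \<open>1 / q\<close>. A common bound for
  the denominators would therefore keep the values away from 1.
\<close>

lemma summable_inverse_Suc_power:
  assumes "s \<ge> 2"
  shows "summable (\<lambda>m. 1 / real (Suc m) ^ s)"
  using inverse_power_summable[OF assms, where 'a = real]
  by (subst summable_Suc_iff) (simp add: inverse_eq_divide)

lemma exponent_ge:
  fixes a b k :: nat
  assumes "a > 0" "b > 0"
  shows "a * k + b \<ge> k + 1"
proof -
  have "1 * k \<le> a * k"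
    using assms(1) by (intro mult_le_mono1) simp
  then show ?thesis
    using assms(2) by linarith
qed

lemma zeta_ab_minus_1_eq:
  assumes "a > 0" "b > 0" "k > 0"
  shows "zeta_ab a b k - 1 = (\<Sum>m. 1 / real (m + 2) ^ (a * k + b))"
    and "summable (\<lambda>m. 1 / real (m + 2) ^ (a * k + b))"
proof -
  let ?f = "\<lambda>m. 1 / real (Suc m) ^ (a * k + b)"
  have "a * k + b \<ge> 2"
    using exponent_ge[OF assms(1,2), of k] assms(3) by linarith
  then have f: "summable ?f"
    by (rule summable_inverse_Suc_power)
  show "summable (\<lambda>m. 1 / real (m + 2) ^ (a * k + b))"
    using f by (subst (asm) summable_Suc_iff[symmetric]) simp
  show "zeta_ab a b k - 1 = (\<Sum>m. 1 / real (m + 2) ^ (a * k + b))"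
    using suminf_split_head[OF f] by (simp add: zeta_ab_def)
qed

lemma zeta_ab_gt_1:
  assumes "a > 0" "b > 0" "k > 0"
  shows "zeta_ab a b k > 1"
proof -
  have "(\<Sum>m. 1 / real (m + 2) ^ (a * k + b)) > 0"
    using zeta_ab_minus_1_eq(2)[OF assms] by (rule suminf_pos) simp
  then show ?thesis
    using zeta_ab_minus_1_eq(1)[OF assms] by linarith
qed

text \<open>
  Of the at least \<open>k + 1\<close> factors \<open>1 / (m + 2)\<close> in a term, two are kept to make the series
  converge; each of the others, of which there are at least \<open>k - 1\<close>, is at most \<open>1 / 2\<close>.
\<close>

lemma zeta_ab_minus_1_le:
  assumes "a > 0" "b > 0" "k > 0"
  shows "zeta_ab a b k - 1 \<le> (\<Sum>m. 1 / real (m + 2) ^ 2) * (1 / 2) ^ (k - 1)"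
proof -
  have C: "summable (\<lambda>m. 1 / real (m + 2) ^ 2)"
    using summable_inverse_Suc_power[OF order_refl]
    by (subst (asm) summable_Suc_iff[symmetric]) simp
  have "1 / real (m + 2) ^ (a * k + b) \<le> 1 / real (m + 2) ^ 2 * (1 / 2) ^ (k - 1)" for m
  proof -
    have "real (m + 2) ^ 2 * 2 ^ (k - 1) \<le> real (m + 2) ^ 2 * real (m + 2) ^ (k - 1)"
      by (intro mult_left_mono power_mono) auto
    also have "\<dots> = real (m + 2) ^ (k + 1)"
      using assms(3) by (simp flip: power_add)
    also have "\<dots> \<le> real (m + 2) ^ (a * k + b)"
      using exponent_ge[OF assms(1,2)] by (intro power_increasing) auto
    finally have "1 / real (m + 2) ^ (a * k + b) \<le> 1 / (real (m + 2) ^ 2 * 2 ^ (k - 1))"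
      by (intro divide_left_mono) auto
    then show ?thesis
      by (simp add: power_one_over)
  qed
  then have "(\<Sum>m. 1 / real (m + 2) ^ (a * k + b))
      \<le> (\<Sum>m. 1 / real (m + 2) ^ 2 * (1 / 2) ^ (k - 1))"
    using zeta_ab_minus_1_eq(2)[OF assms] summable_mult2[OF C] by (intro suminf_le) auto
  then show ?thesis
    using zeta_ab_minus_1_eq(1)[OF assms] suminf_mult2[OF C] by simp
qed

lemma fraction_minus_1_ge:
  fixes p q :: nat
  assumes "q > 0" "real p / real q > 1"
  shows "real p / real q - 1 \<ge> 1 / real q"
proof -
  have "p \<ge> q + 1"
    using assms by (simp add: field_simps)
  then have "real p \<ge> real q + 1"
    by linarith
  then show ?thesis
    using assms(1) by (simp add: field_simps)
qed

theorem theorem1p1: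
  fixes a b :: nat and R :: real and p q :: "nat \<Rightarrow> nat"
  assumes "a > 0" and "b > 0" and "R > 0"
    and "\<And>k. real k \<ge> R \<Longrightarrow> zeta_ab a b k \<in> \<rat>"
    and "\<And>k. real k \<ge> R \<Longrightarrow>
           p k > 0 \<and> q k > 0 \<and> coprime (p k) (q k) \<and> real (p k) / real (q k) = zeta_ab a b k"
  shows "\<not> bdd_above (q ` {k. real k \<ge> R})"
proof
  assume "bdd_above (q ` {k. real k \<ge> R})"
  then obtain B where B: "\<And>k. real k \<ge> R \<Longrightarrow> q k \<le> B"
    by (auto simp: bdd_above_def)
  define C :: real where "C = (\<Sum>m. 1 / real (m + 2) ^ 2)"
  have "(\<lambda>n. C * (1 / 2) ^ n) \<longlonglongrightarrow> C * 0"
    by (intro tendsto_mult_left LIMSEQ_power_zero) simp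
  \<comment> \<open>The \<open>+ 1\<close> makes the threshold positive even for \<open>B = 0\<close>.\<close>
  then have "\<forall>\<^sub>F n in sequentially. C * (1 / 2) ^ n < 1 / (real B + 1)"
    by (rule order_tendstoD) (simp add: add_nonneg_pos)
  moreover have "\<forall>\<^sub>F n in sequentially. real n \<ge> R"
    using filterlim_real_sequentially by (simp add: filterlim_at_top)
  ultimately have "\<forall>\<^sub>F n in sequentially. C * (1 / 2) ^ n < 1 / (real B + 1) \<and> real n \<ge> R"
    by (rule eventually_conj)
  then obtain n where n: "C * (1 / 2) ^ n < 1 / (real B + 1)" "real n \<ge> R"
    by (auto dest: eventually_happens)
  define k where "k = Suc n"
  have k: "real k \<ge> R" "k > 0"
    using n(2) by (simp_all add: k_def)
  have pq: "q k > 0" "real (p k) / real (q k) = zeta_ab a b k"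
    using assms(5)[OF k(1)] by auto
  have "1 / (real B + 1) \<le> 1 / real (q k)"
    using B[OF k(1)] pq(1) by (intro divide_left_mono) auto
  also have "\<dots> \<le> zeta_ab a b k - 1"
    using fraction_minus_1_ge[of "q k" "p k"] pq zeta_ab_gt_1[OF assms(1,2) k(2)] by simp
  also have "\<dots> \<le> C * (1 / 2) ^ n"
    using zeta_ab_minus_1_le[OF assms(1,2) k(2)] by (simp add: C_def k_def)
  finally show False
    using n(1) by simp
qed

end
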